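(* Let $\mathbf Q\in\mathbb R^{n\times n}$ be symmetric positive definite, let $Z\subseteq\{0,1\}^n$, and let $$X_{Q,Z}=\left\{(\mathbf x,\mathbf z,x_0)\in\mathbb R^n\times\{0,1\}^n\times\mathbb R:\ x_0\ge\mathbf x^\top\mathbf Q\mathbf x,\ \mathbf x\circ(\mathbf 1-\mathbf z)=\mathbf 0,\ \mathbf z\in Z\right\}.$$ Let $(N,A)$, with value assignments $\nu_a$ and transition vectors $\mathbf u_a$ ($a\in A$), be the compressed decision diagram for $\mathbf Q$ and $Z$ (see context). Then $(\mathbf x,\mathbf z,x_0)\in\mathbb R^n\times\mathbb R^n\times\mathbb R$ satisfies $(\mathbf x,\mathbf z,x_0)\in\mathrm{conv}(X_{Q,Z})$ if and only if there exist $\mathbf r,\mathbf w\in\mathbb R^A$ such that \begin{align*} &x_0\ge\sum_{a\in A}\frac{w_a^2}{r_a},\\ &\mathbf x=\sum_{a\in A}\mathbf u_a w_a,\\ &\mathbf z=\sum_{a\in A:\,\nu_a=1}\mathbf e_{\ell(a)}r_a,\\ &\sum_{a\in A:\,h_a=v}r_a=\sum_{a\in A:\,t_a=v}r_a\qquad\forall v\in N:\ 2\le\ell(v)\le n,\\ &\sum_{a\in A:\,\ell(a)=1}r_a=1,\qquad\sum_{a\in A:\,\ell(a)=n}r_a=1,\qquad\mathbf r\ge\mathbf 0. \end{align*}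
   Context: Conventions: $\circ$ is the Hadamard (entrywise) product; $\mathrm{conv}$ is the convex hull; $0/0=0$ and $c/0=+\infty$ for $c>0$; $\mathbf e_i$ is the $i$-th standard basis vector and $\mathbf Q_\ell$ the $\ell$-th column of $\mathbf Q$. For an arc $a$, $t_a$ and $h_a$ denote its tail and head nodes and $\ell(a)$ the layer from which it emanates; for a node $v$, $\ell(v)$ is its layer. Relevant index: $\pi_i=\max\{j\in\{1,\dots,n\}:Q_{ij}\ne0\}$. Compressed transition: for an $n\times n$ matrix $\bar{\mathbf W}^\ell$ in layer $\ell\in\{1,\dots,n\}$, let $$\mathbf u=\frac{1}{\sqrt{Q_{\ell\ell}-\sum_{i=1}^n\sum_{j=1}^n\bar W^\ell_{ij}Q_{i\ell}Q_{j\ell}}}\left(-\sum_{i=1}^n\bar{\mathbf W}^\ell_iQ_{i\ell}+\mathbf e_\ell\right)\qquad( * )$$ where $\bar{\mathbf W}^\ell_i$ is the $i$-th column, and for $\hat z\in\{0,1\}$ let $\phi(\bar{\mathbf W}^\ell,\hat z)=\bar{\mathbf W}^{\ell+1}$ with $$\bar W^{\ell+1}_{ij}=\begin{cases}0&\text{if }\ell\ge\pi_j\\ \bar W^\ell_{ij}&\text{if }\ell<\pi_j,\ \hat z=0\\ \bar W^\ell_{ij}+u_iu_j&\text{if }\ell<\pi_j,\ \hat z=1.\end{cases}$$ Compressed decision diagram for $Z=\{0,1\}^n$: layered directed acyclic (multi)graph with layers $1,\dots,n+1$; layer 1 contains only the root, with state $\mathbf 0_{n\times n}$; the nodes of layer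 $\ell+1$ are the distinct matrices obtained by applying $\phi(\cdot,\hat z)$, $\hat z\in\{0,1\}$, to the states of layer $\ell$, and for each state $s$ in layer $\ell\le n$ and each $\hat z\in\{0,1\}$ there is an arc $a$ from $s$ to $\phi(s,\hat z)$ with $\nu_a=\hat z$. The transition vector is $\mathbf u_a=\mathbf 0$ if $\nu_a=0$, and is given by $( * )$ with $\bar{\mathbf W}^\ell$ the matrix stored at $t_a$ if $\nu_a=1$. For general $Z$, the state is enlarged by the state of a dynamic program encoding $Z$: a node is a pair (matrix, $\sigma$), where $\sigma$ evolves by a (layer-dependent) deterministic transition function $\sigma\mapsto\psi_\ell(\sigma,\hat z)$ from a given initial state, which may return "infeasible", such that $\mathbf z\in Z$ if and only if the successive transitions with $\hat z=z_1,\dots,z_n$ are all feasible; the matrix component starts at $\mathbf 0_{n\times n}$ at the root and evolves by the compressed transition $\phi$, that is, along an arc $a$ emanating from layer $\ell$ with $\nu_a=\hat z$ the matrix $\bar{\mathbf W}^\ell$ stored at $t_a$ is replaced at $h_a$ by $\phi(\bar{\mathbf W}^\ell,\hat z)$, with transition vector $\mathbf u_a=\mathbf 0$ if $\hat z=0$ and $\mathbf u_a=\mathbf u$ computed from $\bar{\mathbf W}^\ell$ by $( * )$ if $\hat z=1$; infeasible states are removed (together with the arcs into them), and states in the same layer are identified exactly when both components coincide. Thus root-to-terminal paths $(a_1,\dots,a_n)$ are in one-to-one correspondence with points $\mathbf z=(\nu_{a_1},\dots,\nu_{a_n})\in Z$. *)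

theory Defs
  imports "HOL-Analysis.Analysis"
begin

text \<open>
  Throughout, \<open>ix :: nat \<Rightarrow> 'n\<close> is a numbering of the coordinates: a bijection from
  \<open>{1..CARD('n)}\<close> onto \<open>'n\<close>. The number \<open>n\<close> is \<open>CARD('n)\<close>, and \<open>x $ ix k\<close> is the \<open>k\<close>-th
  coordinate of \<open>x\<close>. Layers are natural numbers \<open>1, \<dots>, n + 1\<close>.
\<close>

definition binary_cube :: "(real^'n) set" where
  "binary_cube = {z. \<forall>i. z $ i \<in> {0, 1}}"

definition hadamard :: "real^'n \<Rightarrow> real^'n \<Rightarrow> real^'n" (infixl "\<circ>\<^sub>H" 70) where
  "x \<circ>\<^sub>H y = (\<chi> i. x $ i * y $ i)"

definition pos_def_matrix :: "real^'n^'n \<Rightarrow> bool" where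
  "pos_def_matrix Q \<longleftrightarrow> (\<forall>x. x \<noteq> 0 \<longrightarrow> x \<bullet> (Q *v x) > 0)"

definition X_set :: "real^'n^'n \<Rightarrow> (real^'n) set \<Rightarrow> ((real^'n) \<times> (real^'n) \<times> real) set" where
  "X_set Q Z = {(x, z, x0). z \<in> binary_cube \<and> x0 \<ge> x \<bullet> (Q *v x) \<and>
                            x \<circ>\<^sub>H ((\<chi> i. 1) - z) = 0 \<and> z \<in> Z}"

definition last_relevant :: "(nat \<Rightarrow> 'n) \<Rightarrow> real^'n^'n \<Rightarrow> 'n \<Rightarrow> nat" where
  "last_relevant ix Q i = Max {j \<in> {1..CARD('n)}. Q $ i $ ix j \<noteq> 0}"

definition trans_vec :: "(nat \<Rightarrow> 'n) \<Rightarrow> real^'n^'n \<Rightarrow> nat \<Rightarrow> real^'n^'n \<Rightarrow> real^'n" where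
  "trans_vec ix Q l W =
     (1 / sqrt (Q $ ix l $ ix l - (\<Sum>i\<in>UNIV. \<Sum>j\<in>UNIV. W $ i $ j * Q $ i $ ix l * Q $ j $ ix l)))
       *\<^sub>R (- (\<Sum>i\<in>UNIV. Q $ i $ ix l *\<^sub>R column i W) + axis (ix l) 1)"

definition compressed_trans ::
  "(nat \<Rightarrow> 'n) \<Rightarrow> real^'n^'n \<Rightarrow> nat \<Rightarrow> real^'n^'n \<Rightarrow> bool \<Rightarrow> real^'n^'n" where
  "compressed_trans ix Q l W b =
     (\<chi> i j. if l \<ge> last_relevant ix Q j then 0
             else if \<not> b then W $ i $ j
             else W $ i $ j + trans_vec ix Q l W $ i * trans_vec ix Q l W $ j)"

text \<open>
  A dynamic program with states in \<open>'s\<close> is given by its initial state \<open>\<sigma>0\<close> and its transition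
  function \<open>\<psi>\<close>; \<open>\<psi> l \<sigma> b = None\<close> means that the decision \<open>b\<close> in layer \<open>l\<close> is infeasible.
  \<open>dp_state ix \<psi> \<sigma>0 z k\<close> is the outcome of the first \<open>k\<close> decisions prescribed by \<open>z\<close>.
\<close>

primrec dp_state ::
  "(nat \<Rightarrow> 'n) \<Rightarrow> (nat \<Rightarrow> 's \<Rightarrow> bool \<Rightarrow> 's option) \<Rightarrow> 's \<Rightarrow> real^'n \<Rightarrow> nat \<Rightarrow> 's option" where
  "dp_state ix \<psi> \<sigma>0 z 0 = Some \<sigma>0"
| "dp_state ix \<psi> \<sigma>0 z (Suc k) =
     Option.bind (dp_state ix \<psi> \<sigma>0 z k) (\<lambda>\<sigma>. \<psi> (Suc k) \<sigma> (z $ ix (Suc k) = 1))"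

definition dp_encodes ::
  "(nat \<Rightarrow> 'n) \<Rightarrow> (nat \<Rightarrow> 's \<Rightarrow> bool \<Rightarrow> 's option) \<Rightarrow> 's \<Rightarrow> (real^'n) set \<Rightarrow> bool" where
  "dp_encodes ix \<psi> \<sigma>0 Z \<longleftrightarrow>
     (\<forall>z\<in>binary_cube. z \<in> Z \<longleftrightarrow> dp_state ix \<psi> \<sigma>0 z CARD('n) \<noteq> None)"

text \<open>
  A node is a triple (layer, matrix, state of the dynamic program). An arc is a pair of its tail
  and its value, so the two arcs out of a node stay distinct even when their heads coincide.
\<close>

type_synonym ('n, 's) dd_node = "nat \<times> (real^'n^'n) \<times> 's"
type_synonym ('n, 's) dd_arc = "('n, 's) dd_node \<times> bool"

inductive_set dd_nodes ::
  "(nat \<Rightarrow> 'n) \<Rightarrow> real^'n^'n \<Rightarrow> (nat \<Rightarrow> 's \<Rightarrow> bool \<Rightarrow> 's option) \<Rightarrow> 's \<Rightarrow> ('n::finite, 's) dd_node set"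
  for ix :: "nat \<Rightarrow> 'n" and Q :: "real^'n^'n"
    and \<psi> :: "nat \<Rightarrow> 's \<Rightarrow> bool \<Rightarrow> 's option" and \<sigma>0 :: 's
where
  root: "(1, 0, \<sigma>0) \<in> dd_nodes ix Q \<psi> \<sigma>0"
| step: "(l, W, \<sigma>) \<in> dd_nodes ix Q \<psi> \<sigma>0 \<Longrightarrow> l \<le> CARD('n) \<Longrightarrow> \<psi> l \<sigma> b = Some \<sigma>' \<Longrightarrow>
           (Suc l, compressed_trans ix Q l W b, \<sigma>') \<in> dd_nodes ix Q \<psi> \<sigma>0"

definition dd_arcs ::
  "(nat \<Rightarrow> 'n) \<Rightarrow> real^'n^'n \<Rightarrow> (nat \<Rightarrow> 's \<Rightarrow> bool \<Rightarrow> 's option) \<Rightarrow> 's \<Rightarrow> ('n::finite, 's) dd_arc set" where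
  "dd_arcs ix Q \<psi> \<sigma>0 =
     {((l, W, \<sigma>), b) | l W \<sigma> b.
        (l, W, \<sigma>) \<in> dd_nodes ix Q \<psi> \<sigma>0 \<and> l \<le> CARD('n) \<and> \<psi> l \<sigma> b \<noteq> None}"

definition node_layer :: "('n::finite, 's) dd_node \<Rightarrow> nat" where
  "node_layer v = fst v"

definition arc_tail :: "('n::finite, 's) dd_arc \<Rightarrow> ('n, 's) dd_node" where
  "arc_tail a = fst a"

definition arc_value :: "('n::finite, 's) dd_arc \<Rightarrow> bool" where
  "arc_value a = snd a"

definition arc_layer :: "('n::finite, 's) dd_arc \<Rightarrow> nat" where
  "arc_layer a = node_layer (arc_tail a)"

definition arc_head ::
  "(nat \<Rightarrow> 'n) \<Rightarrow> real^'n^'n \<Rightarrow> (nat \<Rightarrow> 's \<Rightarrow> bool \<Rightarrow> 's option) \<Rightarrow>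
     ('n::finite, 's) dd_arc \<Rightarrow> ('n, 's) dd_node" where
  "arc_head ix Q \<psi> a =
     (case a of ((l, W, \<sigma>), b) \<Rightarrow> (Suc l, compressed_trans ix Q l W b, the (\<psi> l \<sigma> b)))"

definition arc_vec ::
  "(nat \<Rightarrow> 'n) \<Rightarrow> real^'n^'n \<Rightarrow> ('n::finite, 's) dd_arc \<Rightarrow> real^'n" where
  "arc_vec ix Q a = (case a of ((l, W, \<sigma>), b) \<Rightarrow> if b then trans_vec ix Q l W else 0)"

text \<open>The arc set is finite, so sums over arcs are not trivialised by the convention for infinite sets.\<close>

lemma finite_dd_nodes: "finite (dd_nodes ix Q \<psi> \<sigma>0 :: ('n::finite, 's) dd_node set)"
proof -
  let ?N = "dd_nodes ix Q \<psi> \<sigma>0 :: ('n, 's) dd_node set"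
  let ?L = "\<lambda>k. {v \<in> ?N. fst v = k}"
  have layer: "l \<in> {1..Suc CARD('n)}" if "(l, W, \<sigma>) \<in> ?N" for l W \<sigma>
    using that by induction auto
  have "finite (?L k)" for k
  proof (induction k)
    case 0
    have "?L 0 = {}" using layer by fastforce
    then show ?case by (metis finite.emptyI)
  next
    case (Suc k)
    let ?g = "\<lambda>((l, W, \<sigma>), b). (Suc l, compressed_trans ix Q l W b, the (\<psi> l \<sigma> b))"
    have "?L (Suc k) \<subseteq> insert (1, 0, \<sigma>0) (?g ` (?L k \<times> UNIV))"
    proof
      fix v assume "v \<in> ?L (Suc k)"
      then have v: "v \<in> ?N" "fst v = Suc k" by auto
      obtain m V \<tau> where vt: "v = (m, V, \<tau>)" by (cases v)
      from v(1)[unfolded vt] show "v \<in> insert (1, 0, \<sigma>0) (?g ` (?L k \<times> UNIV))"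
      proof (cases rule: dd_nodes.cases)
        case root
        then show ?thesis using vt by simp
      next
        case (step l W \<sigma> b)
        then have "v = ?g ((l, W, \<sigma>), b)" "((l, W, \<sigma>), b) \<in> ?L k \<times> UNIV"
          using v(2) vt by auto
        then show ?thesis by blast
      qed
    qed
    then show ?case using Suc by (simp add: finite_subset)
  qed
  moreover have "?N \<subseteq> (\<Union>k\<in>{1..Suc CARD('n)}. ?L k)" using layer by fastforce
  ultimately show ?thesis by (meson finite_UN finite_atLeastAtMost finite_subset)
qed

lemma finite_dd_arcs: "finite (dd_arcs ix Q \<psi> \<sigma>0 :: ('n::finite, 's) dd_arc set)"
  by (rule finite_subset[of _ "dd_nodes ix Q \<psi> \<sigma>0 \<times> UNIV"])
     (auto simp: dd_arcs_def finite_dd_nodes)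

text \<open>
  Division of extended reals agrees with the convention \<open>0/0 = 0\<close> and \<open>c/0 = \<infinity>\<close> for \<open>c > 0\<close>;
  division of reals does not.
\<close>

lemma ereal_divide_zero_convention:
  "ereal 0 / ereal 0 = 0" "c > 0 \<Longrightarrow> ereal c / ereal 0 = \<infinity>"
  by (simp_all add: divide_ereal_def)

end

theory Submission
  imports Defs
begin

text \<open>
  Compression only deletes matrix entries that are later multiplied by zero entries of \<open>Q\<close>, so along
  a path the transition vectors are those of Gram-Schmidt orthogonalisation, with respect to the
  inner product of \<open>Q\<close>, of the basis vectors \<open>axis (ix k) 1\<close> with \<open>z $ ix k = 1\<close>. The points \<open>x\<close>
  supported on \<open>z\<close> are therefore exactly the combinations of the transition vectors of the path of
  \<open>z\<close>, and the quadratic form is the sum of the squared coefficients. Hence every point of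
  \<open>X_set Q Z\<close> is feasible through a unit flow along one path, and convexity of \<open>w\<^sup>2 / r\<close> extends this
  to the convex hull. Conversely, a unit flow \<open>r\<close> is a convex combination of paths; putting the
  coefficient \<open>w a / r a\<close> on every arc \<open>a\<close> of each of these paths gives points of \<open>X_set Q Z\<close> whose
  combination is \<open>(x, z, \<Sum>a. (w a)\<^sup>2 / r a)\<close>.
\<close>

section \<open>Quadratic-over-linear terms and division by zero\<close>

text \<open>Joint convexity of \<open>c^2 / a\<close>, written as subadditivity: for positive
  denominators the gap is \<open>(b * c - a * d)^2 / (a * b * (a + b))\<close>. A zero denominator
  comes with a zero numerator, so its term simply drops out.\<close>

lemma power2_sum_divide_le:
  fixes a b c d :: real
  assumes "a \<ge> 0" "b \<ge> 0" "a = 0 \<Longrightarrow> c = 0" "b = 0 \<Longrightarrow> d = 0"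
  shows "(c + d)\<^sup>2 / (a + b) \<le> c\<^sup>2 / a + d\<^sup>2 / b"
proof (cases "a = 0 \<or> b = 0")
  case False
  then have pos: "a > 0" "b > 0" using assms by auto
  then have "c\<^sup>2 / a + d\<^sup>2 / b - (c + d)\<^sup>2 / (a + b) = (b * c - a * d)\<^sup>2 / (a * b * (a + b))"
    by (simp add: divide_simps) (simp add: power2_eq_square algebra_simps)
  moreover have "(b * c - a * d)\<^sup>2 / (a * b * (a + b)) \<ge> 0" using pos by simp
  ultimately show ?thesis by linarith
qed (use assms in auto)

text \<open>Transfers the cost constraint to real division. A single term \<open>c / 0\<close> with
  \<open>c > 0\<close> makes the extended sum infinite, which no real bound admits; in all other
  cases both divisions agree.\<close>

lemma ereal_quotient_sum_le_iff:
  fixes r w :: "'a \<Rightarrow> real"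
  assumes fin: "finite A" and r: "\<forall>a\<in>A. r a \<ge> 0"
  shows "(\<Sum>a\<in>A. ereal ((w a)\<^sup>2) / ereal (r a)) \<le> ereal s \<longleftrightarrow>
    (\<forall>a\<in>A. r a = 0 \<longrightarrow> w a = 0) \<and> (\<Sum>a\<in>A. (w a)\<^sup>2 / r a) \<le> s"
proof (cases "\<forall>a\<in>A. r a = 0 \<longrightarrow> w a = 0")
  case True
  have "ereal ((w a)\<^sup>2) / ereal (r a) = ereal ((w a)\<^sup>2 / r a)" if "a \<in> A" for a
    using True that by (cases "r a = 0") (auto simp: zero_ereal_def[symmetric])
  then have "(\<Sum>a\<in>A. ereal ((w a)\<^sup>2) / ereal (r a)) = ereal (\<Sum>a\<in>A. (w a)\<^sup>2 / r a)"
    by simp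
  then show ?thesis using True by simp
next
  case False
  then obtain a where a: "a \<in> A" "r a = 0" "w a \<noteq> 0" by blast
  then have "ereal ((w a)\<^sup>2) / ereal (r a) = \<infinity>"
    using ereal_divide_zero_convention(2)[of "(w a)\<^sup>2"] by simp
  then have "(\<Sum>a\<in>A. ereal ((w a)\<^sup>2) / ereal (r a)) = \<infinity>"
    using fin a(1) by (subst sum_Pinfty) blast
  then show ?thesis using False by simp
qed

section \<open>Gram-Schmidt vectors along a path\<close>

text \<open>For symmetric positive definite \<open>Q\<close> this is the inner product used in the
  orthogonalisation below.\<close>

definition mat_form :: "real^'n^'n \<Rightarrow> real^'n \<Rightarrow> real^'n \<Rightarrow> real" where
  "mat_form Q x y = x \<bullet> (Q *v y)"

lemma bilinear_mat_form: "bilinear (mat_form Q)"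
  unfolding mat_form_def bilinear_def
  by (intro conjI allI linearI)
    (simp_all add: inner_add_left inner_add_right matrix_vector_right_distrib matrix_vector_mult_scaleR)

lemmas mat_form_simps =
  bilinear_ladd[OF bilinear_mat_form] bilinear_radd[OF bilinear_mat_form]
  bilinear_lmul[OF bilinear_mat_form] bilinear_rmul[OF bilinear_mat_form]
  bilinear_lsub[OF bilinear_mat_form] bilinear_rsub[OF bilinear_mat_form]
  bilinear_lzero[OF bilinear_mat_form] bilinear_rzero[OF bilinear_mat_form]

lemma mat_form_sum_left: "mat_form Q (\<Sum>i\<in>I. f i) y = (\<Sum>i\<in>I. mat_form Q (f i) y)"
  unfolding mat_form_def by (rule inner_sum_left)

lemma mat_form_sum_right: "mat_form Q x (\<Sum>i\<in>I. f i) = (\<Sum>i\<in>I. mat_form Q x (f i))"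
  unfolding mat_form_def
  by (simp add: linear_sum[OF matrix_vector_mul_linear] inner_sum_right)

lemma mat_form_commute:
  assumes "transpose Q = Q"
  shows "mat_form Q x y = mat_form Q y x"
proof -
  have "x \<bullet> (Q *v y) = (x v* Q) \<bullet> y" by (simp add: dot_lmul_matrix)
  also have "x v* Q = Q *v x" using transpose_matrix_vector[of Q x] assms by simp
  finally show ?thesis by (simp add: mat_form_def inner_commute)
qed

lemma mat_form_axis: "mat_form Q x (axis k 1) = (\<Sum>i\<in>UNIV. x $ i * Q $ i $ k)"
  unfolding mat_form_def matrix_vector_mult_basis by (simp add: inner_vec_def column_def)

locale numbered_pd_matrix =
  fixes ix :: "nat \<Rightarrow> 'n::finite" and Q :: "real^'n^'n"
  assumes numbering: "bij_betw ix {1..CARD('n)} UNIV"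
    and Q_sym: "transpose Q = Q"
    and Q_pos_def: "pos_def_matrix Q"
begin

lemma ix_eq_iff: "j \<in> {1..CARD('n)} \<Longrightarrow> k \<in> {1..CARD('n)} \<Longrightarrow> ix j = ix k \<longleftrightarrow> j = k"
  using numbering by (meson bij_betw_def inj_on_eq_iff)

lemma ix_surj: "\<exists>k\<in>{1..CARD('n)}. i = ix k"
  using bij_betw_imp_surj_on[OF numbering] by (metis UNIV_I imageE)

text \<open>Indexed by the number of decisions taken: \<open>path_matrix z k\<close> is stored in
  layer \<open>k + 1\<close>, so the transition vector of layer \<open>k\<close> uses
  \<open>path_matrix z (k - 1)\<close>.\<close>

primrec path_matrix :: "real^'n \<Rightarrow> nat \<Rightarrow> real^'n^'n" where
  "path_matrix z 0 = 0"
| "path_matrix z (Suc k) =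
     compressed_trans ix Q (Suc k) (path_matrix z k) (z $ ix (Suc k) = 1)"

definition path_vec :: "real^'n \<Rightarrow> nat \<Rightarrow> real^'n" where
  "path_vec z k = (if z $ ix k = 1 then trans_vec ix Q k (path_matrix z (k - 1)) else 0)"

text \<open>Each active layer adds the outer product of its transition vector. A deleted column
  stays deleted, since the deletion condition is monotone in \<open>k\<close>.\<close>

lemma path_matrix_eq:
  "path_matrix z k $ i $ j =
     (if last_relevant ix Q j \<le> k then 0 else \<Sum>m=1..k. path_vec z m $ i * path_vec z m $ j)"
proof (induction k)
  case (Suc k)
  have "path_vec z (Suc k) = (if z $ ix (Suc k) = 1 then trans_vec ix Q (Suc k) (path_matrix z k) else 0)"
    by (simp add: path_vec_def)
  then show ?case using Suc by (simp add: compressed_trans_def)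
qed simp

lemma last_relevant_ge: "k \<in> {1..CARD('n)} \<Longrightarrow> Q $ i $ ix k \<noteq> 0 \<Longrightarrow> k \<le> last_relevant ix Q i"
  unfolding last_relevant_def by (rule Max_ge) auto

text \<open>The entries deleted by the compression are multiplied by a vanishing entry of \<open>Q\<close>.\<close>

lemma path_matrix_times_Q:
  assumes "Suc k \<le> CARD('n)"
  shows "path_matrix z k $ i $ j * Q $ j $ ix (Suc k) =
    (\<Sum>m=1..k. path_vec z m $ i * path_vec z m $ j) * Q $ j $ ix (Suc k)"
proof (cases "Q $ j $ ix (Suc k) = 0")
  case False
  then have "\<not> last_relevant ix Q j \<le> k" using last_relevant_ge[of "Suc k" j] assms by simp
  then show ?thesis by (simp add: path_matrix_eq)
qed simp

text \<open>The Gram-Schmidt residual before normalisation: the next basis vector minus its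
  projections on the earlier transition vectors.\<close>

definition residual :: "real^'n \<Rightarrow> nat \<Rightarrow> real^'n" where
  "residual z k = axis (ix (Suc k)) 1 -
     (\<Sum>m=1..k. mat_form Q (path_vec z m) (axis (ix (Suc k)) 1) *\<^sub>R path_vec z m)"

text \<open>By \<open>path_matrix_times_Q\<close> the stored matrix acts on column
  \<open>ix (Suc k)\<close> of \<open>Q\<close> like the full sum of outer products. That action
  produces the projections, and the double sum under the root becomes the sum of their squared
  coefficients.\<close>

lemma trans_vec_path_matrix:
  assumes k: "Suc k \<le> CARD('n)"
  shows "trans_vec ix Q (Suc k) (path_matrix z k) =
    (1 / sqrt (Q $ ix (Suc k) $ ix (Suc k) -
      (\<Sum>m=1..k. (mat_form Q (path_vec z m) (axis (ix (Suc k)) 1))\<^sup>2))) *\<^sub>R residual z k"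
proof -
  let ?l = "ix (Suc k)" and ?W = "path_matrix z k" and ?u = "path_vec z"
  let ?q = "\<lambda>m. mat_form Q (?u m) (axis ?l 1)"
  have row: "(\<Sum>j\<in>UNIV. ?W $ i $ j * Q $ j $ ?l) = (\<Sum>m=1..k. ?q m * ?u m $ i)" for i
  proof -
    have "(\<Sum>j\<in>UNIV. ?W $ i $ j * Q $ j $ ?l) =
        (\<Sum>j\<in>UNIV. \<Sum>m=1..k. ?u m $ i * ?u m $ j * Q $ j $ ?l)"
      using path_matrix_times_Q[OF k] by (simp add: sum_distrib_right)
    also have "\<dots> = (\<Sum>m=1..k. \<Sum>j\<in>UNIV. ?u m $ i * ?u m $ j * Q $ j $ ?l)" by (rule sum.swap)
    also have "\<dots> = (\<Sum>m=1..k. ?q m * ?u m $ i)"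
      by (simp add: mat_form_axis sum_distrib_right sum_distrib_left mult_ac)
    finally show ?thesis .
  qed
  have "(\<Sum>i\<in>UNIV. \<Sum>j\<in>UNIV. ?W $ i $ j * Q $ i $ ?l * Q $ j $ ?l) =
      (\<Sum>i\<in>UNIV. Q $ i $ ?l * (\<Sum>j\<in>UNIV. ?W $ i $ j * Q $ j $ ?l))"
    by (simp add: sum_distrib_left mult_ac)
  also have "\<dots> = (\<Sum>i\<in>UNIV. \<Sum>m=1..k. ?q m * (?u m $ i * Q $ i $ ?l))"
    unfolding row by (simp add: sum_distrib_left mult_ac)
  also have "\<dots> = (\<Sum>m=1..k. \<Sum>i\<in>UNIV. ?q m * (?u m $ i * Q $ i $ ?l))" by (rule sum.swap)
  also have "\<dots> = (\<Sum>m=1..k. (?q m)\<^sup>2)"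
    by (simp add: mat_form_axis power2_eq_square sum_distrib_left)
  finally have D: "(\<Sum>i\<in>UNIV. \<Sum>j\<in>UNIV. ?W $ i $ j * Q $ i $ ?l * Q $ j $ ?l) = (\<Sum>m=1..k. (?q m)\<^sup>2)" .
  have "- (\<Sum>i\<in>UNIV. Q $ i $ ?l *\<^sub>R column i ?W) + axis ?l 1 = residual z k"
  proof (rule vec_eq_iff[THEN iffD2], rule allI)
    fix i
    have "(\<Sum>j\<in>UNIV. Q $ j $ ?l * ?W $ i $ j) = (\<Sum>m=1..k. ?q m * ?u m $ i)"
      using row[of i] by (simp add: mult.commute)
    then show "(- (\<Sum>i\<in>UNIV. Q $ i $ ?l *\<^sub>R column i ?W) + axis ?l 1) $ i = residual z k $ i"
      by (simp add: residual_def column_def)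
  qed
  then show ?thesis unfolding trans_vec_def D by simp
qed

text \<open>Triangularity: a path vector is a multiple of one basis vector minus a combination of
  earlier path vectors, so strong induction confines its support to active coordinates up to its own
  layer.\<close>

lemma path_vec_support:
  assumes "m \<in> {1..CARD('n)}" "j \<in> {1..CARD('n)}" "path_vec z m $ ix j \<noteq> 0"
  shows "j \<le> m \<and> z $ ix j = 1"
  using assms
proof (induction m rule: less_induct)
  case (less m)
  obtain k where m: "m = Suc k" using less.prems(1) by (cases m) auto
  have z1: "z $ ix m = 1" using less.prems(3) by (auto simp: path_vec_def split: if_splits)
  with less.prems m have "residual z k $ ix j \<noteq> 0"
    by (auto simp: path_vec_def trans_vec_path_matrix)
  moreover have "residual z k $ ix j = 0"
    if "axis (ix m) (1::real) $ ix j = 0" "\<forall>i\<in>{1..k}. path_vec z i $ ix j = 0"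
    using that by (simp add: residual_def m)
  ultimately consider "axis (ix m) (1::real) $ ix j \<noteq> 0"
    | i where "i \<in> {1..k}" "path_vec z i $ ix j \<noteq> 0"
    by blast
  then show ?case
  proof cases
    case 1
    then have "j = m" using ix_eq_iff less.prems(1,2) by (auto simp: axis_def split: if_splits)
    then show ?thesis using z1 by simp
  next
    case 2
    then show ?thesis using less.IH[of i] less.prems m by fastforce
  qed
qed

lemma path_vec_inactive: "z $ ix m \<noteq> 1 \<Longrightarrow> path_vec z m = 0"
  by (simp add: path_vec_def)

text \<open>By triangularity the earlier vectors vanish at the new coordinate, where only the basis
  vector contributes. In particular the residual is nonzero.\<close>

lemma residual_diag:
  assumes k: "Suc k \<le> CARD('n)"
  shows "residual z k $ ix (Suc k) = 1"
proof -
  have "path_vec z m $ ix (Suc k) = 0" if "m \<in> {1..k}" for m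
    using path_vec_support[of m "Suc k" z] that k by fastforce
  then show ?thesis by (simp add: residual_def)
qed

text \<open>Gram-Schmidt with respect to \<open>Q\<close>, where inactive layers contribute zero
  vectors; this accounts for the condition on \<open>z\<close> inside
  \<open>of_bool\<close>.\<close>

lemma path_vec_orthonormal:
  assumes "j \<in> {1..k}" "m \<in> {1..k}" "k \<le> CARD('n)"
  shows "mat_form Q (path_vec z j) (path_vec z m) = of_bool (j = m \<and> z $ ix m = 1)"
  using assms
proof (induction k arbitrary: j m)
  case (Suc k)
  let ?u = "path_vec z" and ?e = "axis (ix (Suc k)) 1 :: real^'n" and ?p = "residual z k"
  let ?q = "\<lambda>m. mat_form Q (?u m) ?e"
  have orth: "mat_form Q (?u i) ?p = 0" if i: "i \<in> {1..k}" for i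
  proof -
    have "mat_form Q (?u i) ?p = ?q i - (\<Sum>m=1..k. ?q m * mat_form Q (?u i) (?u m))"
      by (simp add: residual_def mat_form_simps mat_form_sum_right)
    also have "(\<Sum>m=1..k. ?q m * mat_form Q (?u i) (?u m)) =
        (\<Sum>m=1..k. if i = m then ?q m * of_bool (z $ ix m = 1) else 0)"
      using i Suc.IH Suc.prems(3) by (intro sum.cong) auto
    \<comment> \<open>In an inactive layer \<open>?u i\<close> is zero, hence so is
      \<open>?q i\<close>; this absorbs the factor \<open>of_bool\<close>.\<close>
    also have "\<dots> = ?q i"
      using i path_vec_inactive[of z i] by (auto simp: mat_form_simps)
    finally show ?thesis by simp
  qed
  \<comment> \<open>Pythagoras: since \<open>?p\<close> is orthogonal to the earlier vectors, its
    squared \<open>Q\<close>-norm is exactly the radicand of \<open>trans_vec_path_matrix\<close>,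
    so the scaling factor normalises it.\<close>
  have "mat_form Q ?p ?p = mat_form Q ?e ?p - (\<Sum>m=1..k. ?q m * mat_form Q (?u m) ?p)"
    by (subst (1) residual_def) (simp add: mat_form_simps mat_form_sum_left)
  also have "\<dots> = mat_form Q ?e ?p" using orth by simp
  also have "\<dots> = mat_form Q ?e ?e - (\<Sum>m=1..k. ?q m * mat_form Q ?e (?u m))"
    by (subst (1) residual_def) (simp add: mat_form_simps mat_form_sum_right)
  also have "\<dots> = Q $ ix (Suc k) $ ix (Suc k) - (\<Sum>m=1..k. (?q m)\<^sup>2)"
  proof -
    have "mat_form Q ?e ?e = Q $ ix (Suc k) $ ix (Suc k)"
      by (simp add: mat_form_axis) (simp add: axis_def if_distrib[of "\<lambda>x. x * _"] cong: if_cong)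
    moreover have "mat_form Q ?e (?u m) = ?q m" for m by (rule mat_form_commute[OF Q_sym])
    ultimately show ?thesis by (simp add: power2_eq_square)
  qed
  finally have pp: "mat_form Q ?p ?p = Q $ ix (Suc k) $ ix (Suc k) - (\<Sum>m=1..k. (?q m)\<^sup>2)" .
  have "?p \<noteq> 0" using residual_diag[OF Suc.prems(3), of z] by auto
  then have pos: "mat_form Q ?p ?p > 0"
    using Q_pos_def by (simp add: pos_def_matrix_def mat_form_def)
  have u: "?u (Suc k) = (of_bool (z $ ix (Suc k) = 1) / sqrt (mat_form Q ?p ?p)) *\<^sub>R ?p"
    using trans_vec_path_matrix[OF Suc.prems(3), of z] by (simp add: path_vec_def pp)
  have last: "mat_form Q (?u i) (?u (Suc k)) = 0" if "i \<in> {1..k}" for i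
    using orth[OF that] by (simp add: u mat_form_simps)
  have unit: "mat_form Q (?u (Suc k)) (?u (Suc k)) = of_bool (z $ ix (Suc k) = 1)"
    using pos by (simp add: u mat_form_simps)
  consider "j \<in> {1..k}" "m \<in> {1..k}" | "j \<in> {1..k}" "m = Suc k" | "j = Suc k" "m \<in> {1..k}"
    | "j = Suc k" "m = Suc k"
    using Suc.prems by (auto simp: le_Suc_eq)
  then show ?case
  proof cases
    case 1
    then show ?thesis using Suc by simp
  next
    case 2
    then show ?thesis using last by auto
  next
    case 3
    then have "mat_form Q (?u (Suc k)) (?u m) = 0"
      using last[of m] mat_form_commute[OF Q_sym, of "?u (Suc k)" "?u m"] by simp
    then show ?thesis using 3 by simp
  next
    case 4
    then show ?thesis using unit by simp
  qed
qed simp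

text \<open>A zero there would force the scaling factor of the residual to vanish, hence the whole
  vector, contradicting its unit \<open>Q\<close>-norm.\<close>

lemma path_vec_diag:
  assumes "m \<in> {1..CARD('n)}" "z $ ix m = 1"
  shows "path_vec z m $ ix m \<noteq> 0"
proof
  assume 0: "path_vec z m $ ix m = 0"
  obtain k where m: "m = Suc k" using assms by (cases m) auto
  have "residual z k $ ix m = 1" using residual_diag assms m by simp
  with 0 have "path_vec z m = 0"
    using assms m trans_vec_path_matrix[of k z] by (auto simp: path_vec_def)
  then show False
    using path_vec_orthonormal[of m "CARD('n)" m z] assms by (simp add: mat_form_simps)
qed

text \<open>Parseval's identity for the orthonormal path vectors; coefficients of inactive layers
  multiply zero vectors and do not count.\<close>

lemma quadratic_form_path_vec:
  "(\<Sum>m=1..CARD('n). c m *\<^sub>R path_vec z m) \<bullet> (Q *v (\<Sum>m=1..CARD('n). c m *\<^sub>R path_vec z m)) =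
     (\<Sum>m=1..CARD('n). if z $ ix m = 1 then (c m)\<^sup>2 else 0)"
proof -
  have "mat_form Q (\<Sum>m=1..CARD('n). c m *\<^sub>R path_vec z m) (\<Sum>m=1..CARD('n). c m *\<^sub>R path_vec z m) =
      (\<Sum>j=1..CARD('n). \<Sum>m=1..CARD('n). c j * (c m * mat_form Q (path_vec z j) (path_vec z m)))"
    by (subst mat_form_sum_left, subst mat_form_sum_right)
      (simp only: mat_form_simps real_scaleR_def mult.left_commute)
  also have "\<dots> = (\<Sum>j=1..CARD('n). \<Sum>m=1..CARD('n).
      if j = m then (if z $ ix m = 1 then (c m)\<^sup>2 else 0) else 0)"
    by (intro sum.cong refl)
      (simp add: path_vec_orthonormal[of _ "CARD('n)"] power2_eq_square)
  also have "\<dots> = (\<Sum>m=1..CARD('n). if z $ ix m = 1 then (c m)\<^sup>2 else 0)" by simp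
  finally show ?thesis by (simp add: mat_form_def)
qed

text \<open>Back substitution: the path vectors are triangular with nonzero diagonal on active
  coordinates, so the last coordinate can be eliminated and the rest handled by induction.\<close>

lemma path_vec_span:
  assumes "\<And>j. j \<in> {1..CARD('n)} \<Longrightarrow> x $ ix j \<noteq> 0 \<Longrightarrow> j \<le> k \<and> z $ ix j = 1"
    and "k \<le> CARD('n)"
  shows "\<exists>c. x = (\<Sum>m=1..k. c m *\<^sub>R path_vec z m)"
  using assms
proof (induction k arbitrary: x)
  case 0
  have "x $ i = 0" for i
    using ix_surj[of i] 0(1) by fastforce
  then show ?case by (simp add: vec_eq_iff)
next
  case (Suc k)
  \<comment> \<open>If coordinate \<open>Suc k\<close> is inactive, the denominator is 0 and so
    \<open>a = 0\<close>.\<close>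
  define a where "a = x $ ix (Suc k) / path_vec z (Suc k) $ ix (Suc k)"
  have "\<exists>c. x - a *\<^sub>R path_vec z (Suc k) = (\<Sum>m=1..k. c m *\<^sub>R path_vec z m)"
  proof (rule Suc.IH)
    fix j assume j: "j \<in> {1..CARD('n)}" "(x - a *\<^sub>R path_vec z (Suc k)) $ ix j \<noteq> 0"
    then have "x $ ix j \<noteq> 0 \<or> path_vec z (Suc k) $ ix j \<noteq> 0" by auto
    then have *: "j \<le> Suc k \<and> z $ ix j = 1"
      using Suc.prems j(1) path_vec_support[of "Suc k" j z] by auto
    moreover have "j \<noteq> Suc k"
      using j * path_vec_diag[of "Suc k" z] by (auto simp: a_def)
    ultimately show "j \<le> k \<and> z $ ix j = 1" by simp
  qed (use Suc.prems in simp)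
  then obtain c where c: "x - a *\<^sub>R path_vec z (Suc k) = (\<Sum>m=1..k. c m *\<^sub>R path_vec z m)" ..
  have "x = (\<Sum>m=1..k. c m *\<^sub>R path_vec z m) + a *\<^sub>R path_vec z (Suc k)"
    unfolding c[symmetric] by simp
  also have "\<dots> = (\<Sum>m=1..Suc k. (c(Suc k := a)) m *\<^sub>R path_vec z m)"
    by simp
  finally show ?case by blast
qed

end

section \<open>Paths of the diagram\<close>

locale compressed_diagram = numbered_pd_matrix ix Q
  for ix :: "nat \<Rightarrow> 'n::finite" and Q :: "real^'n^'n" +
  fixes \<psi> :: "nat \<Rightarrow> 's \<Rightarrow> bool \<Rightarrow> 's option" and \<sigma>0 :: 's
begin

abbreviation nodes :: "('n, 's) dd_node set" where "nodes \<equiv> dd_nodes ix Q \<psi> \<sigma>0"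
abbreviation arcs :: "('n, 's) dd_arc set" where "arcs \<equiv> dd_arcs ix Q \<psi> \<sigma>0"
abbreviation head :: "('n, 's) dd_arc \<Rightarrow> ('n, 's) dd_node" where "head \<equiv> arc_head ix Q \<psi>"
abbreviation state :: "real^'n \<Rightarrow> nat \<Rightarrow> 's option" where "state \<equiv> dp_state ix \<psi> \<sigma>0"

text \<open>Lies in layer \<open>k + 1\<close>. It is meaningful only when the first
  \<open>k\<close> decisions of \<open>z\<close> are feasible; otherwise \<open>the\<close> returns
  an unspecified state.\<close>

definition path_node :: "real^'n \<Rightarrow> nat \<Rightarrow> ('n, 's) dd_node" where
  "path_node z k = (Suc k, path_matrix z k, the (state z k))"

definition path_arc :: "real^'n \<Rightarrow> nat \<Rightarrow> ('n, 's) dd_arc" where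
  "path_arc z k = (path_node z (k - 1), z $ ix k = 1)"

lemma node_layer_path_node [simp]: "node_layer (path_node z k) = Suc k"
  by (simp add: node_layer_def path_node_def)

lemma arc_tail_path_arc [simp]: "arc_tail (path_arc z k) = path_node z (k - 1)"
  by (simp add: arc_tail_def path_arc_def)

lemma arc_layer_path_arc [simp]: "k \<ge> 1 \<Longrightarrow> arc_layer (path_arc z k) = k"
  by (simp add: arc_layer_def)

lemma arc_value_path_arc [simp]: "arc_value (path_arc z k) \<longleftrightarrow> z $ ix k = 1"
  by (simp add: arc_value_def path_arc_def)

lemma arc_vec_path_arc: "k \<ge> 1 \<Longrightarrow> arc_vec ix Q (path_arc z k) = path_vec z k"
  by (simp add: arc_vec_def path_arc_def path_node_def path_vec_def)

lemma state_Suc_obtain: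
  assumes "state z (Suc k) \<noteq> None"
  obtains \<sigma> \<sigma>' where "state z k = Some \<sigma>" "\<psi> (Suc k) \<sigma> (z $ ix (Suc k) = 1) = Some \<sigma>'"
    "state z (Suc k) = Some \<sigma>'"
  using assms by (cases "state z k") auto

lemma state_mono: "state z k \<noteq> None \<Longrightarrow> j \<le> k \<Longrightarrow> state z j \<noteq> None"
  by (induction k) (auto simp: le_Suc_eq bind_eq_Some_conv)

lemma path_node_in_nodes: "k \<le> CARD('n) \<Longrightarrow> state z k \<noteq> None \<Longrightarrow> path_node z k \<in> nodes"
proof (induction k)
  case 0
  then show ?case using dd_nodes.root by (simp add: path_node_def)
next
  case (Suc k)
  obtain \<sigma> \<sigma>' where s: "state z k = Some \<sigma>" "\<psi> (Suc k) \<sigma> (z $ ix (Suc k) = 1) = Some \<sigma>'"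
    "state z (Suc k) = Some \<sigma>'"
    using state_Suc_obtain Suc.prems(2) by blast
  then have "(Suc k, path_matrix z k, \<sigma>) \<in> nodes"
    using Suc by (simp add: path_node_def)
  from dd_nodes.step[OF this _ s(2)] show ?case
    using Suc.prems(1) by (simp add: path_node_def s(3) del: dp_state.simps)
qed

lemma head_path_arc:
  assumes "k \<ge> 1" "state z k \<noteq> None"
  shows "head (path_arc z k) = path_node z k"
proof -
  obtain j where k: "k = Suc j" using assms(1) by (cases k) auto
  then show ?thesis
    using assms(2) by (auto simp: path_arc_def path_node_def arc_head_def bind_eq_Some_conv)
qed

lemma path_arc_in_arcs:
  assumes "k \<in> {1..CARD('n)}" "state z k \<noteq> None"
  shows "path_arc z k \<in> arcs"
proof -
  obtain j where k: "k = Suc j" using assms(1) by (cases k) auto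
  have "path_node z j \<in> nodes" using path_node_in_nodes[of j z] state_mono[of z k j] assms k by simp
  then show ?thesis
    using assms unfolding k
    by (auto simp: path_arc_def path_node_def dd_arcs_def bind_eq_Some_conv)
qed

text \<open>Allows a path to be extended by resetting a later coordinate of \<open>z\<close> while
  its prefix stays the same.\<close>

lemma path_prefix_cong:
  assumes "\<And>j. j \<in> {1..k} \<Longrightarrow> z $ ix j = y $ ix j"
  shows "path_node z k = path_node y k \<and> state z k = state y k"
proof -
  have "path_matrix z k = path_matrix y k \<and> state z k = state y k"
    using assms by (induction k) simp_all
  then show ?thesis by (simp add: path_node_def)
qed

section \<open>Layers of nodes and arcs\<close>

lemma node_layer_range:
  assumes "v \<in> nodes"
  shows "node_layer v \<in> {1..Suc CARD('n)}"
proof -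
  have "l \<in> {1..Suc CARD('n)}" if "(l, W, \<sigma>) \<in> nodes" for l W \<sigma>
    using that by induction auto
  then show ?thesis using assms by (cases v) (auto simp: node_layer_def)
qed

text \<open>Every node created by a step has layer at least 2, so the root is alone in layer 1 and
  the source equation speaks of its outflow.\<close>

lemma node_layer_1:
  assumes "v \<in> nodes"
  shows "node_layer v = 1 \<longleftrightarrow> v = path_node z 0"
proof -
  obtain l' W' \<tau> where v: "v = (l', W', \<tau>)" by (cases v)
  from assms[unfolded v] show ?thesis
  proof (cases rule: dd_nodes.cases)
    case root
    then show ?thesis by (simp add: v node_layer_def path_node_def)
  next
    case (step l W \<sigma> b)
    then have "l \<ge> 1" using node_layer_range by (fastforce simp: node_layer_def)
    then show ?thesis using step by (simp add: v node_layer_def path_node_def)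
  qed
qed

lemma arc_tail_in_nodes: "a \<in> arcs \<Longrightarrow> arc_tail a \<in> nodes"
  by (auto simp: dd_arcs_def arc_tail_def)

lemma arc_head_in_nodes: "a \<in> arcs \<Longrightarrow> head a \<in> nodes"
  by (auto simp: dd_arcs_def arc_head_def intro: dd_nodes.step)

lemma arc_layer_range: "a \<in> arcs \<Longrightarrow> arc_layer a \<in> {1..CARD('n)}"
  using node_layer_range[OF arc_tail_in_nodes, of a]
  by (auto simp: arc_layer_def dd_arcs_def arc_tail_def node_layer_def)

lemma node_layer_head: "node_layer (head a) = Suc (arc_layer a)"
  by (auto simp: arc_layer_def arc_tail_def node_layer_def arc_head_def split: prod.split)

section \<open>Decomposition of flows into paths\<close>

text \<open>The totals of \<open>g\<close> along all feasible root-to-\<open>v\<close> paths. Vector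
  values let a single decomposition treat \<open>x\<close>, \<open>z\<close> and the cost
  together.\<close>

definition path_sums :: "(('n, 's) dd_arc \<Rightarrow> 'v::real_vector) \<Rightarrow> nat \<Rightarrow> ('n, 's) dd_node \<Rightarrow> 'v set"
  where "path_sums g k v =
    {\<Sum>j=1..k. g (path_arc z j) | z. z \<in> binary_cube \<and> state z k \<noteq> None \<and> path_node z k = v}"

text \<open>Take the point \<open>z\<close> of a path to the tail and reset its coordinate
  \<open>Suc k\<close> to the value of \<open>a\<close>. The path of the new point keeps its first
  \<open>k\<close> arcs and continues with \<open>a\<close>.\<close>

lemma path_sums_extend:
  assumes a: "a \<in> arcs" "arc_layer a = Suc k" and y: "y \<in> path_sums g k (arc_tail a)"
  shows "g a + y \<in> path_sums g (Suc k) (head a)"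
proof -
  obtain z where z: "z \<in> binary_cube" "state z k \<noteq> None" "path_node z k = arc_tail a"
    and y_eq: "y = (\<Sum>j=1..k. g (path_arc z j))"
    using y by (auto simp: path_sums_def)
  have k: "Suc k \<le> CARD('n)" using arc_layer_range a by fastforce
  define z' where "z' = (\<chi> i. if i = ix (Suc k) then of_bool (arc_value a) else z $ i)"
  have agree: "z' $ ix j = z $ ix j" if "j \<in> {1..k}" for j
    using that k ix_eq_iff[of j "Suc k"] by (simp add: z'_def)
  have last: "(z' $ ix (Suc k) = 1) = arc_value a" by (simp add: z'_def)
  have z'_bin: "z' \<in> binary_cube" using z(1) by (simp add: z'_def binary_cube_def)
  have pre: "path_node z' j = path_node z j \<and> state z' j = state z j" if "j \<le> k" for j
    using path_prefix_cong[of j z' z] agree that by simp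
  have arc_z': "path_arc z' (Suc k) = a"
    using pre[of k] z(3) last by (simp add: path_arc_def arc_tail_def arc_value_def)
  obtain l W \<sigma> b where a_eq: "a = ((l, W, \<sigma>), b)" and feas: "\<psi> l \<sigma> b \<noteq> None"
    using a(1) by (auto simp: dd_arcs_def)
  have "l = Suc k" "the (state z k) = \<sigma>" "b = arc_value a"
    using z(3) by (auto simp: a_eq path_node_def arc_tail_def arc_value_def)
  then have st: "state z' (Suc k) \<noteq> None"
    using feas z(2) pre[of k] last by auto
  have "path_arc z' j = path_arc z j" if "j \<in> {1..k}" for j
  proof -
    have "j - 1 \<le> k" using that by auto
    then show ?thesis using pre[of "j - 1"] agree[OF that] by (simp add: path_arc_def)
  qed
  then have "(\<Sum>j=1..Suc k. g (path_arc z' j)) = g a + y"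
    by (simp add: y_eq arc_z')
  moreover have "path_node z' (Suc k) = head a"
    using head_path_arc[of "Suc k" z'] st arc_z' by simp
  ultimately show ?thesis unfolding path_sums_def mem_Collect_eq using z'_bin st by metis
qed

definition flow_conservation :: "(('n, 's) dd_arc \<Rightarrow> real) \<Rightarrow> bool" where
  "flow_conservation r \<longleftrightarrow> (\<forall>v\<in>nodes. 2 \<le> node_layer v \<and> node_layer v \<le> CARD('n) \<longrightarrow>
     (\<Sum>a\<in>{a\<in>arcs. head a = v}. r a) = (\<Sum>a\<in>{a\<in>arcs. arc_tail a = v}. r a))"

text \<open>The inflow of a node; the root, which no arc enters, is credited with the unit
  supply.\<close>

definition node_flow :: "(('n, 's) dd_arc \<Rightarrow> real) \<Rightarrow> ('n, 's) dd_node \<Rightarrow> real" where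
  "node_flow r v = (if node_layer v = 1 then 1 else \<Sum>a\<in>{a\<in>arcs. head a = v}. r a)"

text \<open>At the root this is the source equation, as all arcs of layer 1 leave the root;
  elsewhere it is flow conservation.\<close>

lemma node_flow_out:
  assumes "flow_conservation r" "(\<Sum>a\<in>{a\<in>arcs. arc_layer a = 1}. r a) = 1"
    and v: "v \<in> nodes" "node_layer v \<le> CARD('n)"
  shows "node_flow r v = (\<Sum>a\<in>{a\<in>arcs. arc_tail a = v}. r a)"
proof (cases "node_layer v = 1")
  case True
  then have "{a\<in>arcs. arc_layer a = 1} = {a\<in>arcs. arc_tail a = v}"
    using v(1) arc_tail_in_nodes unfolding arc_layer_def
    by (metis (no_types, lifting) node_layer_1)
  then show ?thesis using assms(2) True by (simp add: node_flow_def)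
next
  case False
  then have "2 \<le> node_layer v" using node_layer_range[OF v(1)] by simp
  then show ?thesis using assms(1) v False by (auto simp: node_flow_def flow_conservation_def)
qed

text \<open>
  \<open>F v\<close> is the average of the path sums over the flow that has arrived at \<open>v\<close>; passing to the next
  layer averages \<open>g a + F (arc_tail a)\<close> over the arcs into a node with weights proportional to \<open>r a\<close>.
\<close>

lemma flow_decomposition_step:
  fixes g :: "('n, 's) dd_arc \<Rightarrow> 'v::real_vector"
  assumes nonneg: "\<And>a. a \<in> arcs \<Longrightarrow> r a \<ge> 0"
    and cons: "flow_conservation r" and source: "(\<Sum>a\<in>{a\<in>arcs. arc_layer a = 1}. r a) = 1"
    and "k \<le> CARD('n)"
  shows "\<exists>F. (\<forall>v\<in>nodes. node_layer v = Suc k \<and> node_flow r v > 0 \<longrightarrow>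
        F v \<in> convex hull (path_sums g k v)) \<and>
      (\<Sum>v\<in>{v\<in>nodes. node_layer v = Suc k}. node_flow r v *\<^sub>R F v) =
      (\<Sum>a\<in>{a\<in>arcs. arc_layer a \<le> k}. r a *\<^sub>R g a)"
  using \<open>k \<le> CARD('n)\<close>
proof (induction k)
  case 0
  have "0 \<in> path_sums g 0 v" if "v \<in> nodes" "node_layer v = Suc 0" for v
  proof -
    have "0 \<in> binary_cube" "state 0 0 \<noteq> None" "path_node 0 0 = v"
      using that node_layer_1[of v 0] by (auto simp: binary_cube_def)
    then show ?thesis by (force simp: path_sums_def)
  qed
  moreover have "{a\<in>arcs. arc_layer a \<le> 0} = {}" using arc_layer_range by fastforce
  then have "(\<Sum>a\<in>{a\<in>arcs. arc_layer a \<le> 0}. r a *\<^sub>R g a) = 0" by (simp only: sum.empty)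
  ultimately show ?case by (intro exI[of _ "\<lambda>_. 0"]) (auto intro: hull_inc)
next
  case (Suc k)
  then obtain F where F: "\<And>v. v \<in> nodes \<Longrightarrow> node_layer v = Suc k \<Longrightarrow> node_flow r v > 0 \<Longrightarrow>
        F v \<in> convex hull (path_sums g k v)"
    and F_sum: "(\<Sum>v\<in>{v\<in>nodes. node_layer v = Suc k}. node_flow r v *\<^sub>R F v) =
      (\<Sum>a\<in>{a\<in>arcs. arc_layer a \<le> k}. r a *\<^sub>R g a)"
    by auto
  define I where "I v = {a\<in>arcs. head a = v}" for v
  have fin: "finite (I v)" for v by (simp add: I_def finite_dd_arcs)
  \<comment> \<open>Where no flow arrives, \<open>1 / 0 = 0\<close> gives \<open>F' v = 0\<close>;
    this is harmless, because all \<open>r a\<close> on the incoming arcs are then zero.\<close>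
  define F' where "F' v = (1 / node_flow r v) *\<^sub>R (\<Sum>a\<in>I v. r a *\<^sub>R (g a + F (arc_tail a)))" for v
  have flow: "node_flow r v = sum r (I v)" if "node_layer v = Suc (Suc k)" for v
    using that by (simp add: node_flow_def I_def)
  have hull: "F' v \<in> convex hull (path_sums g (Suc k) v)"
    if v: "v \<in> nodes" "node_layer v = Suc (Suc k)" "node_flow r v > 0" for v
  proof -
    \<comment> \<open>Only arcs that carry flow are kept: the induction hypothesis places
      \<open>F (arc_tail a)\<close> in a hull only if the tail has positive flow.\<close>
    define J where "J = {a\<in>I v. r a > 0}"
    have J: "J \<subseteq> I v" "finite J" using fin[of v] by (auto simp: J_def)
    have J_zero: "r a = 0" if "a \<in> I v - J" for a
      using that nonneg[of a] by (auto simp: J_def I_def)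
    have "F' v = (\<Sum>a\<in>J. (r a / node_flow r v) *\<^sub>R (g a + F (arc_tail a)))"
      unfolding F'_def scaleR_sum_right using J fin[of v] J_zero
      by (intro sum.mono_neutral_cong_right) auto
    also have "\<dots> \<in> convex hull (path_sums g (Suc k) v)"
    proof (rule convex_sum)
      have "sum r J = sum r (I v)" using J fin[of v] J_zero by (intro sum.mono_neutral_left) auto
      then show "(\<Sum>a\<in>J. r a / node_flow r v) = 1"
        using flow[OF v(2)] v(3) by (simp add: sum_divide_distrib[symmetric])
    next
      fix a assume "a \<in> J"
      then have a: "a \<in> arcs" "head a = v" "r a > 0" by (auto simp: J_def I_def)
      show "r a / node_flow r v \<ge> 0" using a v(3) by simp
      have la: "arc_layer a = Suc k" using node_layer_head[of a] a v(2) by simp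
      \<comment> \<open>Positive flow on \<open>a\<close> forces positive outflow, hence positive
        node flow, at its tail.\<close>
      have "r a \<le> (\<Sum>b\<in>{b\<in>arcs. arc_tail b = arc_tail a}. r b)"
        using a nonneg by (intro member_le_sum) (auto simp: finite_dd_arcs)
      also have "\<dots> = node_flow r (arc_tail a)"
        using node_flow_out[OF cons source arc_tail_in_nodes[OF a(1)]] la Suc.prems
        by (simp add: arc_layer_def)
      finally have "F (arc_tail a) \<in> convex hull (path_sums g k (arc_tail a))"
        using F[OF arc_tail_in_nodes[OF a(1)]] la a(3) by (simp add: arc_layer_def)
      then have "g a + F (arc_tail a) \<in> convex hull ((+) (g a) ` path_sums g k (arc_tail a))"
        by (simp add: convex_hull_translation)
      also have "\<dots> \<subseteq> convex hull (path_sums g (Suc k) v)"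
        using path_sums_extend[OF a(1) la, of _ g] a(2) by (intro hull_mono) auto
      finally show "g a + F (arc_tail a) \<in> convex hull (path_sums g (Suc k) v)" .
    qed (simp_all add: J)
    finally show ?thesis .
  qed
  let ?A = "{a\<in>arcs. arc_layer a = Suc k}"
  have finA: "finite ?A" by (simp add: finite_dd_arcs)
  \<comment> \<open>Double counting of the arcs in layer \<open>Suc k\<close>: grouping by heads
    yields the weighted sum of \<open>F'\<close>, grouping by tails yields that of \<open>F\<close>
    plus the contribution of this layer.\<close>
  have "(\<Sum>v\<in>{v\<in>nodes. node_layer v = Suc (Suc k)}. node_flow r v *\<^sub>R F' v) =
      (\<Sum>v\<in>{v\<in>nodes. node_layer v = Suc (Suc k)}. \<Sum>a\<in>{a\<in>?A. head a = v}. r a *\<^sub>R (g a + F (arc_tail a)))"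
  proof (rule sum.cong)
    fix v assume "v \<in> {v\<in>nodes. node_layer v = Suc (Suc k)}"
    then have v: "node_layer v = Suc (Suc k)" by simp
    then have I_eq: "{a\<in>?A. head a = v} = I v" using node_layer_head by (force simp: I_def)
    have "(\<Sum>a\<in>I v. r a *\<^sub>R (g a + F (arc_tail a))) = 0" if "node_flow r v = 0"
    proof -
      have "\<forall>a\<in>I v. r a = 0"
        using that flow[OF v] nonneg sum_nonneg_eq_0_iff[OF fin, of v r] by (auto simp: I_def)
      then show ?thesis by simp
    qed
    then show "node_flow r v *\<^sub>R F' v = (\<Sum>a\<in>{a\<in>?A. head a = v}. r a *\<^sub>R (g a + F (arc_tail a)))"
      unfolding I_eq by (cases "node_flow r v = 0") (simp_all add: F'_def)
  qed simp
  also have "\<dots> = (\<Sum>a\<in>?A. r a *\<^sub>R (g a + F (arc_tail a)))"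
    using finA by (intro sum.group) (auto simp: finite_dd_nodes arc_head_in_nodes node_layer_head)
  also have "\<dots> = (\<Sum>a\<in>?A. r a *\<^sub>R F (arc_tail a)) + (\<Sum>a\<in>?A. r a *\<^sub>R g a)"
    by (simp add: sum.distrib scaleR_add_right)
  also have "(\<Sum>a\<in>?A. r a *\<^sub>R F (arc_tail a)) =
      (\<Sum>v\<in>{v\<in>nodes. node_layer v = Suc k}. \<Sum>a\<in>{a\<in>?A. arc_tail a = v}. r a *\<^sub>R F (arc_tail a))"
    using finA by (intro sum.group[symmetric])
      (auto simp: finite_dd_nodes arc_tail_in_nodes arc_layer_def)
  also have "\<dots> = (\<Sum>v\<in>{v\<in>nodes. node_layer v = Suc k}. node_flow r v *\<^sub>R F v)"
  proof (rule sum.cong)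
    fix v assume v: "v \<in> {v\<in>nodes. node_layer v = Suc k}"
    then have "{a\<in>?A. arc_tail a = v} = {a\<in>arcs. arc_tail a = v}" by (auto simp: arc_layer_def)
    then show "(\<Sum>a\<in>{a\<in>?A. arc_tail a = v}. r a *\<^sub>R F (arc_tail a)) = node_flow r v *\<^sub>R F v"
      using v node_flow_out[OF cons source, of v] Suc.prems by (simp add: scaleR_left.sum)
  qed simp
  also have "\<dots> = (\<Sum>a\<in>{a\<in>arcs. arc_layer a \<le> k}. r a *\<^sub>R g a)" by (rule F_sum)
  also have "\<dots> + (\<Sum>a\<in>?A. r a *\<^sub>R g a) = (\<Sum>a\<in>{a\<in>arcs. arc_layer a \<le> k} \<union> ?A. r a *\<^sub>R g a)"
    by (rule sum.union_disjoint[symmetric]) (auto simp: finite_dd_arcs)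
  also have "{a\<in>arcs. arc_layer a \<le> k} \<union> ?A = {a\<in>arcs. arc_layer a \<le> Suc k}" by auto
  finally show ?case using hull by blast
qed

text \<open>The sink equation makes the node flows of the terminal layer sum to 1, so they are
  convex weights for the averages from \<open>flow_decomposition_step\<close>.\<close>

lemma flow_decomposition:
  fixes g :: "('n, 's) dd_arc \<Rightarrow> 'v::real_vector"
  assumes nonneg: "\<And>a. a \<in> arcs \<Longrightarrow> r a \<ge> 0" and cons: "flow_conservation r"
    and source: "(\<Sum>a\<in>{a\<in>arcs. arc_layer a = 1}. r a) = 1"
    and sink: "(\<Sum>a\<in>{a\<in>arcs. arc_layer a = CARD('n)}. r a) = 1"
  shows "(\<Sum>a\<in>arcs. r a *\<^sub>R g a) \<in> convex hull
    {\<Sum>j=1..CARD('n). g (path_arc z j) | z. z \<in> binary_cube \<and> state z CARD('n) \<noteq> None}"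
    (is "_ \<in> convex hull ?S")
proof -
  let ?T = "{v\<in>nodes. node_layer v = Suc CARD('n)}"
  let ?P = "{v\<in>?T. node_flow r v > 0}"
  obtain F where F: "\<And>v. v \<in> ?P \<Longrightarrow> F v \<in> convex hull (path_sums g CARD('n) v)"
    and F_sum: "(\<Sum>v\<in>?T. node_flow r v *\<^sub>R F v) =
      (\<Sum>a\<in>{a\<in>arcs. arc_layer a \<le> CARD('n)}. r a *\<^sub>R g a)"
    using flow_decomposition_step[OF nonneg cons source order.refl, of g] by auto
  have fin: "finite ?T" by (simp add: finite_dd_nodes)
  have flow_nonneg: "node_flow r v \<ge> 0" for v
    using nonneg by (auto simp: node_flow_def intro: sum_nonneg)
  have zero: "node_flow r v = 0" if "v \<in> ?T - ?P" for v
    using that flow_nonneg[of v] by auto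
  have "sum (node_flow r) ?P = sum (node_flow r) ?T"
    using fin zero by (intro sum.mono_neutral_left) auto
  also have "\<dots> = (\<Sum>v\<in>?T. \<Sum>a\<in>{a\<in>{a\<in>arcs. arc_layer a = CARD('n)}. head a = v}. r a)"
  proof (rule sum.cong)
    fix v assume "v \<in> ?T"
    then show "node_flow r v = (\<Sum>a\<in>{a\<in>{a\<in>arcs. arc_layer a = CARD('n)}. head a = v}. r a)"
      using node_layer_head by (force simp: node_flow_def intro!: sum.cong)
  qed simp
  also have "\<dots> = (\<Sum>a\<in>{a\<in>arcs. arc_layer a = CARD('n)}. r a)"
    by (rule sum.group) (auto simp: finite_dd_arcs finite_dd_nodes arc_head_in_nodes node_layer_head)
  finally have one: "sum (node_flow r) ?P = 1" using sink by simp
  have "(\<Sum>v\<in>?P. node_flow r v *\<^sub>R F v) \<in> convex hull ?S"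
  proof (rule convex_sum)
    fix v assume "v \<in> ?P"
    moreover have "path_sums g CARD('n) v \<subseteq> ?S" by (auto simp: path_sums_def)
    ultimately show "F v \<in> convex hull ?S" using F hull_mono by blast
  next
    show "finite ?P" using fin by (rule finite_subset[rotated]) auto
  qed (use one flow_nonneg in simp_all)
  also have "(\<Sum>v\<in>?P. node_flow r v *\<^sub>R F v) = (\<Sum>v\<in>?T. node_flow r v *\<^sub>R F v)"
    using fin zero by (intro sum.mono_neutral_left) auto
  also have "\<dots> = (\<Sum>a\<in>arcs. r a *\<^sub>R g a)"
    unfolding F_sum using arc_layer_range by (intro sum.cong) auto
  finally show ?thesis .
qed

section \<open>The extended formulation\<close>

text \<open>The constraint system over real division. The first conjunct stands in for the
  convention \<open>c / 0 = \<infinity>\<close>, as real division would make such terms 0.\<close>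

definition dd_feasible ::
  "real^'n \<Rightarrow> real^'n \<Rightarrow> real \<Rightarrow> (('n, 's) dd_arc \<Rightarrow> real) \<Rightarrow> (('n, 's) dd_arc \<Rightarrow> real) \<Rightarrow> bool" where
  "dd_feasible x z s r w \<longleftrightarrow>
     (\<forall>a\<in>arcs. r a = 0 \<longrightarrow> w a = 0) \<and> (\<Sum>a\<in>arcs. (w a)\<^sup>2 / r a) \<le> s \<and>
     x = (\<Sum>a\<in>arcs. w a *\<^sub>R arc_vec ix Q a) \<and>
     z = (\<Sum>a\<in>{a\<in>arcs. arc_value a}. r a *\<^sub>R axis (ix (arc_layer a)) 1) \<and>
     flow_conservation r \<and>
     (\<Sum>a\<in>{a\<in>arcs. arc_layer a = 1}. r a) = 1 \<and>
     (\<Sum>a\<in>{a\<in>arcs. arc_layer a = CARD('n)}. r a) = 1 \<and>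
     (\<forall>a\<in>arcs. r a \<ge> 0)"

text \<open>All constraints but the cost are preserved by linearity and signs: if a combined flow
  vanishes, so do both of its nonnegative parts. The cost uses \<open>power2_sum_divide_le\<close>
  arc by arc.\<close>

lemma dd_feasible_combination:
  assumes f: "dd_feasible x z s r w" "dd_feasible x' z' s' r' w'"
    and uv: "u \<ge> 0" "v \<ge> 0" "u + v = 1"
  shows "dd_feasible (u *\<^sub>R x + v *\<^sub>R x') (u *\<^sub>R z + v *\<^sub>R z') (u * s + v * s')
    (\<lambda>a. u * r a + v * r' a) (\<lambda>a. u * w a + v * w' a)"
proof -
  note f = f[unfolded dd_feasible_def flow_conservation_def]
  have sum_combine: "(\<Sum>a\<in>I. u * p a + v * q a) = u * sum p I + v * sum q I" for p q :: "_ \<Rightarrow> real" and I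
    by (simp add: sum.distrib sum_distrib_left)
  have zero: "u * w a + v * w' a = 0" if "a \<in> arcs" "u * r a + v * r' a = 0" for a
  proof -
    have "u * r a \<ge> 0" "v * r' a \<ge> 0" using f uv that(1) by simp_all
    with that(2) have "u * r a = 0" "v * r' a = 0" by linarith+
    then show ?thesis using f that(1) by auto
  qed
  have "(\<Sum>a\<in>arcs. (u * w a + v * w' a)\<^sup>2 / (u * r a + v * r' a)) \<le>
      (\<Sum>a\<in>arcs. u * ((w a)\<^sup>2 / r a) + v * ((w' a)\<^sup>2 / r' a))"
  proof (rule sum_mono)
    fix a assume "a \<in> arcs"
    then have "(u * w a + v * w' a)\<^sup>2 / (u * r a + v * r' a) \<le>
        (u * w a)\<^sup>2 / (u * r a) + (v * w' a)\<^sup>2 / (v * r' a)"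
      using f uv by (intro power2_sum_divide_le) auto
    also have "\<dots> = u * ((w a)\<^sup>2 / r a) + v * ((w' a)\<^sup>2 / r' a)"
      by (simp add: power2_eq_square mult.left_commute)
    finally show "(u * w a + v * w' a)\<^sup>2 / (u * r a + v * r' a) \<le>
      u * ((w a)\<^sup>2 / r a) + v * ((w' a)\<^sup>2 / r' a)" .
  qed
  also have "\<dots> \<le> u * s + v * s'"
    unfolding sum_combine using f uv by (intro add_mono mult_left_mono) auto
  finally have cost: "(\<Sum>a\<in>arcs. (u * w a + v * w' a)\<^sup>2 / (u * r a + v * r' a)) \<le> u * s + v * s'" .
  show ?thesis
    unfolding dd_feasible_def flow_conservation_def
  proof (intro conjI)
    show "u *\<^sub>R x + v *\<^sub>R x' = (\<Sum>a\<in>arcs. (u * w a + v * w' a) *\<^sub>R arc_vec ix Q a)"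
      using f by (simp add: scaleR_add_left sum.distrib scaleR_sum_right)
    show "u *\<^sub>R z + v *\<^sub>R z' =
        (\<Sum>a\<in>{a\<in>arcs. arc_value a}. (u * r a + v * r' a) *\<^sub>R axis (ix (arc_layer a)) 1)"
      using f by (simp add: scaleR_add_left sum.distrib scaleR_sum_right)
  qed (use f uv zero cost in \<open>simp_all add: sum_combine\<close>)
qed

section \<open>Points of the mixed-integer set as unit flows along single paths\<close>

text \<open>The arcs of a path lie in different layers, so sums against its indicator can be
  reindexed by layer.\<close>

lemma path_indicator_sum:
  fixes f :: "_ \<Rightarrow> 'v::real_vector"
  assumes "state z CARD('n) \<noteq> None"
  shows "(\<Sum>a\<in>{a\<in>arcs. P a}. of_bool (a \<in> path_arc z ` {1..CARD('n)}) *\<^sub>R f a) =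
    (\<Sum>k=1..CARD('n). of_bool (P (path_arc z k)) *\<^sub>R f (path_arc z k))"
proof -
  let ?S = "path_arc z ` {1..CARD('n)}"
  have sub: "?S \<subseteq> arcs" using path_arc_in_arcs state_mono[OF assms] by auto
  have inj: "inj_on (path_arc z) {1..CARD('n)}"
    by (rule inj_onI) (metis arc_layer_path_arc atLeastAtMost_iff)
  have "(\<Sum>a\<in>{a\<in>arcs. P a}. of_bool (a \<in> ?S) *\<^sub>R f a) = (\<Sum>a\<in>arcs. of_bool (P a) *\<^sub>R of_bool (a \<in> ?S) *\<^sub>R f a)"
    by (rule sum.mono_neutral_cong_left) (auto simp: finite_dd_arcs)
  also have "\<dots> = (\<Sum>a\<in>?S. of_bool (P a) *\<^sub>R f a)"
    using sub by (intro sum.mono_neutral_cong_right) (auto simp: finite_dd_arcs)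
  also have "\<dots> = (\<Sum>k=1..CARD('n). of_bool (P (path_arc z k)) *\<^sub>R f (path_arc z k))"
    by (subst sum.reindex[OF inj]) simp
  finally show ?thesis .
qed

lemma sum_axis_numbering:
  "(\<Sum>k=1..CARD('n). f (ix k) *\<^sub>R axis (ix k) 1) = (\<chi> i. f i)"
proof -
  have "(\<Sum>k=1..CARD('n). f (ix k) *\<^sub>R axis (ix k) 1) = (\<Sum>i\<in>UNIV. f i *\<^sub>R axis i 1)"
    by (rule sum.reindex_bij_betw[OF numbering])
  also have "\<dots> = (\<chi> i. f i)"
    by (simp add: vec_eq_iff axis_def if_distrib[of "\<lambda>x. _ * x"] cong: if_cong)
  finally show ?thesis .
qed

lemma path_axis_sum:
  assumes "z \<in> binary_cube"
  shows "(\<Sum>k=1..CARD('n). of_bool (z $ ix k = 1) *\<^sub>R axis (ix k) 1) = z"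
proof -
  have "(\<Sum>k=1..CARD('n). of_bool (z $ ix k = 1) *\<^sub>R axis (ix k) (1::real)) = (\<chi> i. of_bool (z $ i = 1))"
    by (rule sum_axis_numbering)
  also have "\<dots> = z" using assms by (force simp: binary_cube_def vec_eq_iff)
  finally show ?thesis .
qed

lemma X_set_feasible:
  assumes enc: "dp_encodes ix \<psi> \<sigma>0 Z" and X: "(x, z, s) \<in> X_set Q Z"
  shows "\<exists>r w. dd_feasible x z s r w"
proof -
  have z: "z \<in> binary_cube" "z \<in> Z" and cost: "x \<bullet> (Q *v x) \<le> s"
    and "x \<circ>\<^sub>H ((\<chi> i. 1) - z) = 0"
    using X by (auto simp: X_set_def)
  then have supp: "x $ i \<noteq> 0 \<Longrightarrow> z $ i = 1" for i
    by (auto simp: hadamard_def vec_eq_iff)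
  have st: "state z CARD('n) \<noteq> None" using enc z by (simp add: dp_encodes_def)
  obtain c where x_eq: "x = (\<Sum>k=1..CARD('n). c k *\<^sub>R path_vec z k)"
    using path_vec_span[of x "CARD('n)" z] supp by auto
  define r :: "_ \<Rightarrow> real" where "r a = of_bool (a \<in> path_arc z ` {1..CARD('n)})" for a
  \<comment> \<open>Coefficients on arcs of value 0 are discarded: the transition vector there is
    zero, while a nonzero coefficient would still raise the cost.\<close>
  define w where "w a = (if arc_value a then r a * c (arc_layer a) else 0)" for a
  note ind = path_indicator_sum[OF st, folded r_def]
  have sum_r: "(\<Sum>a\<in>{a\<in>arcs. P a}. r a) = (\<Sum>k=1..CARD('n). of_bool (P (path_arc z k)))" for P
    using ind[where P = P and f = "\<lambda>_. 1 :: real"] by simp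
  have sum_all: "(\<Sum>a\<in>arcs. r a *\<^sub>R f a) = (\<Sum>k=1..CARD('n). f (path_arc z k))"
    for f :: "_ \<Rightarrow> 'v::real_vector"
    using ind[where P = "\<lambda>_. True" and f = f] by simp
  show ?thesis
    unfolding dd_feasible_def flow_conservation_def
  proof (intro exI conjI ballI impI)
    have "(\<Sum>a\<in>arcs. (w a)\<^sup>2 / r a) =
        (\<Sum>a\<in>arcs. r a *\<^sub>R (if arc_value a then (c (arc_layer a))\<^sup>2 else 0))"
      by (intro sum.cong) (auto simp: w_def r_def)
    also have "\<dots> = (\<Sum>k=1..CARD('n). if z $ ix k = 1 then (c k)\<^sup>2 else 0)"
      unfolding sum_all by (intro sum.cong) auto
    also have "\<dots> = x \<bullet> (Q *v x)"
      unfolding x_eq quadratic_form_path_vec ..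
    finally show "(\<Sum>a\<in>arcs. (w a)\<^sup>2 / r a) \<le> s" using cost by simp
  next
    have "(\<Sum>a\<in>arcs. w a *\<^sub>R arc_vec ix Q a) =
        (\<Sum>a\<in>arcs. r a *\<^sub>R (if arc_value a then c (arc_layer a) else 0) *\<^sub>R arc_vec ix Q a)"
      by (intro sum.cong) (auto simp: w_def)
    also have "\<dots> = x"
      unfolding sum_all x_eq
      by (intro sum.cong) (auto simp: arc_vec_path_arc path_vec_inactive)
    finally show "x = (\<Sum>a\<in>arcs. w a *\<^sub>R arc_vec ix Q a)" ..
  next
    have "(\<Sum>a\<in>{a\<in>arcs. arc_value a}. r a *\<^sub>R axis (ix (arc_layer a)) 1) =
        (\<Sum>k=1..CARD('n). of_bool (z $ ix k = 1) *\<^sub>R axis (ix k) (1::real))"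
      unfolding ind by (intro sum.cong) auto
    then show "z = (\<Sum>a\<in>{a\<in>arcs. arc_value a}. r a *\<^sub>R axis (ix (arc_layer a)) 1)"
      using path_axis_sum[OF z(1)] by simp
  next
    fix v :: "('n, 's) dd_node" assume v: "2 \<le> node_layer v \<and> node_layer v \<le> CARD('n)"
    let ?l = "node_layer v"
    let ?b = "of_bool (path_node z (?l - 1) = v) :: real"
    \<comment> \<open>The path enters layer \<open>?l\<close> by its arc \<open>?l - 1\<close> and
      leaves it by its arc \<open>?l\<close>; both sums are 1 if its node in that layer is
      \<open>v\<close>, and 0 otherwise.\<close>
    have "(\<Sum>a\<in>{a\<in>arcs. head a = v}. r a) = (\<Sum>k=1..CARD('n). if k = ?l - 1 then ?b else 0)"
      unfolding sum_r
    proof (intro sum.cong refl)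
      fix k assume k: "k \<in> {1..CARD('n)}"
      then have "head (path_arc z k) = path_node z k"
        using state_mono[OF st] by (intro head_path_arc) auto
      then show "of_bool (head (path_arc z k) = v) = (if k = ?l - 1 then ?b else 0)"
        by auto
    qed
    also have "\<dots> = ?b" using v by auto
    also have "\<dots> = (\<Sum>k=1..CARD('n). if k = ?l then ?b else 0)" using v by auto
    also have "\<dots> = (\<Sum>a\<in>{a\<in>arcs. arc_tail a = v}. r a)"
      unfolding sum_r by (intro sum.cong) auto
    finally show "(\<Sum>a\<in>{a\<in>arcs. head a = v}. r a) = (\<Sum>a\<in>{a\<in>arcs. arc_tail a = v}. r a)" .
  next
    have layer: "(\<Sum>a\<in>{a\<in>arcs. arc_layer a = l}. r a) = 1" if "l \<in> {1..CARD('n)}" for l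
    proof -
      have "(\<Sum>a\<in>{a\<in>arcs. arc_layer a = l}. r a) = (\<Sum>k=1..CARD('n). if k = l then 1 else 0)"
        unfolding sum_r by (intro sum.cong) auto
      then show ?thesis using that by simp
    qed
    show "(\<Sum>a\<in>{a\<in>arcs. arc_layer a = 1}. r a) = 1"
      "(\<Sum>a\<in>{a\<in>arcs. arc_layer a = CARD('n)}. r a) = 1"
      by (rule layer; simp add: Suc_le_eq)+
  qed (auto simp: r_def w_def)
qed

section \<open>From feasible flows back to the convex hull\<close>

lemma path_point_in_X_set:
  assumes enc: "dp_encodes ix \<psi> \<sigma>0 Z" and z: "z \<in> binary_cube" and st: "state z CARD('n) \<noteq> None"
  shows "(\<Sum>k=1..CARD('n). c k *\<^sub>R path_vec z k, z, \<Sum>k=1..CARD('n). (c k)\<^sup>2) \<in> X_set Q Z"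
proof -
  let ?x = "\<Sum>k=1..CARD('n). c k *\<^sub>R path_vec z k"
  \<comment> \<open>Only an inequality, because the right-hand side also counts the coefficients of
    inactive layers.\<close>
  have "?x \<bullet> (Q *v ?x) \<le> (\<Sum>k=1..CARD('n). (c k)\<^sup>2)"
    unfolding quadratic_form_path_vec by (intro sum_mono) simp
  moreover have "?x $ i = 0" if "z $ i \<noteq> 1" for i
  proof -
    obtain j where j: "j \<in> {1..CARD('n)}" "i = ix j" using ix_surj by blast
    then have "path_vec z k $ i = 0" if "k \<in> {1..CARD('n)}" for k
      using path_vec_support[OF that j(1), of z] \<open>z $ i \<noteq> 1\<close> by auto
    then show ?thesis by simp
  qed
  then have "?x \<circ>\<^sub>H ((\<chi> i. 1) - z) = 0"
    by (auto simp: hadamard_def vec_eq_iff simp del: sum_component)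
  moreover have "z \<in> Z" using enc z st by (simp add: dp_encodes_def)
  ultimately show ?thesis using z by (simp add: X_set_def)
qed

text \<open>\<open>X_set Q Z\<close> is closed under raising the last coordinate, and translations
  commute with the convex hull.\<close>

lemma hull_X_set_upward:
  assumes "(x, z, s) \<in> convex hull (X_set Q Z)" "s \<le> s'"
  shows "(x, z, s') \<in> convex hull (X_set Q Z)"
proof -
  let ?d = "(0, 0, s' - s)"
  have "(+) ?d ` X_set Q Z \<subseteq> X_set Q Z" using assms(2) by (auto simp: X_set_def)
  then have "(+) ?d ` (convex hull (X_set Q Z)) \<subseteq> convex hull (X_set Q Z)"
    by (metis convex_hull_translation hull_mono)
  moreover have "?d + (x, z, s) \<in> (+) ?d ` (convex hull (X_set Q Z))"
    using assms(1) by blast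
  ultimately show ?thesis by auto
qed

lemma feasible_in_hull:
  assumes enc: "dp_encodes ix \<psi> \<sigma>0 Z" and feas: "dd_feasible x z s r w"
  shows "(x, z, s) \<in> convex hull (X_set Q Z)"
proof -
  note feas = feas[unfolded dd_feasible_def]
  \<comment> \<open>Contributions of an arc to \<open>x\<close>, \<open>z\<close> and the cost per
    unit of flow. Multiplying by \<open>r a\<close> recovers \<open>w a\<close>, also when
    \<open>r a = 0\<close>, since feasibility then gives \<open>w a = 0\<close>.\<close>
  define g where "g a = ((w a / r a) *\<^sub>R arc_vec ix Q a,
      of_bool (arc_value a) *\<^sub>R axis (ix (arc_layer a)) (1::real), (w a / r a)\<^sup>2)" for a
  let ?S = "{\<Sum>k=1..CARD('n). g (path_arc z k) | z. z \<in> binary_cube \<and> state z CARD('n) \<noteq> None}"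
  have rw: "r a * (w a / r a) = w a" if "a \<in> arcs" for a using feas that by auto
  have "(\<Sum>a\<in>arcs. r a *\<^sub>R g a) = (x, z, \<Sum>a\<in>arcs. (w a)\<^sup>2 / r a)"
  proof (intro prod_eqI)
    show "fst (\<Sum>a\<in>arcs. r a *\<^sub>R g a) = fst (x, z, \<Sum>a\<in>arcs. (w a)\<^sup>2 / r a)"
      using feas rw by (simp add: g_def fst_sum)
    have "(\<Sum>a\<in>arcs. r a *\<^sub>R of_bool (arc_value a) *\<^sub>R axis (ix (arc_layer a)) (1::real)) = z"
      using feas by (simp add: finite_dd_arcs sum.inter_filter) (auto intro!: sum.cong)
    then show "fst (snd (\<Sum>a\<in>arcs. r a *\<^sub>R g a)) = fst (snd (x, z, \<Sum>a\<in>arcs. (w a)\<^sup>2 / r a))"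
      by (simp add: g_def fst_sum snd_sum)
    show "snd (snd (\<Sum>a\<in>arcs. r a *\<^sub>R g a)) = snd (snd (x, z, \<Sum>a\<in>arcs. (w a)\<^sup>2 / r a))"
      by (auto simp: g_def snd_sum power2_eq_square intro!: sum.cong)
  qed
  moreover have "(\<Sum>a\<in>arcs. r a *\<^sub>R g a) \<in> convex hull ?S"
    using feas by (intro flow_decomposition) auto
  moreover have "?S \<subseteq> X_set Q Z"
  proof
    fix p assume "p \<in> ?S"
    then obtain y where y: "y \<in> binary_cube" "state y CARD('n) \<noteq> None"
      and p: "p = (\<Sum>k=1..CARD('n). g (path_arc y k))"
      by blast
    let ?c = "\<lambda>k. w (path_arc y k) / r (path_arc y k)"
    have "(\<Sum>k=1..CARD('n). g (path_arc y k)) =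
        (\<Sum>k=1..CARD('n). (?c k *\<^sub>R path_vec y k,
          of_bool (y $ ix k = 1) *\<^sub>R axis (ix k) (1::real), (?c k)\<^sup>2))"
      by (intro sum.cong) (auto simp: g_def arc_vec_path_arc)
    also have "\<dots> = (\<Sum>k=1..CARD('n). ?c k *\<^sub>R path_vec y k, y, \<Sum>k=1..CARD('n). (?c k)\<^sup>2)"
      using path_axis_sum[OF y(1)] by (intro prod_eqI) (simp_all add: fst_sum snd_sum)
    also have "\<dots> \<in> X_set Q Z"
      using y by (intro path_point_in_X_set[OF enc]) auto
    finally show "p \<in> X_set Q Z" unfolding p .
  qed
  ultimately have "(x, z, \<Sum>a\<in>arcs. (w a)\<^sup>2 / r a) \<in> convex hull (X_set Q Z)"
    using hull_mono[of ?S "X_set Q Z" convex] by auto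
  then show ?thesis using hull_X_set_upward feas by blast
qed

text \<open>The feasible points form a convex set containing \<open>X_set Q Z\<close>, so they
  contain its hull; the converse is \<open>feasible_in_hull\<close>.\<close>

lemma hull_X_set_iff_feasible:
  assumes "dp_encodes ix \<psi> \<sigma>0 Z"
  shows "(x, z, s) \<in> convex hull (X_set Q Z) \<longleftrightarrow> (\<exists>r w. dd_feasible x z s r w)"
proof
  let ?C = "{(x, z, s). \<exists>r w. dd_feasible x z s r w}"
  have "X_set Q Z \<subseteq> ?C" using X_set_feasible[OF assms] by auto
  moreover have "convex ?C"
  proof (rule convexI)
    fix p q :: "(real^'n) \<times> (real^'n) \<times> real" and u v :: real
    assume pq: "p \<in> ?C" "q \<in> ?C" and uv: "u \<ge> 0" "v \<ge> 0" "u + v = 1"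
    obtain x z s x' z' s' where eq: "p = (x, z, s)" "q = (x', z', s')" by (metis prod_cases3)
    obtain r w r' w' where "dd_feasible x z s r w" "dd_feasible x' z' s' r' w'"
      using pq unfolding eq by blast
    from dd_feasible_combination[OF this uv] show "u *\<^sub>R p + v *\<^sub>R q \<in> ?C"
      by (auto simp: eq)
  qed
  ultimately have "convex hull (X_set Q Z) \<subseteq> ?C" by (rule hull_minimal)
  then show "(x, z, s) \<in> convex hull (X_set Q Z) \<Longrightarrow> \<exists>r w. dd_feasible x z s r w" by auto
qed (use feasible_in_hull[OF assms] in blast)

end

theorem theorem2:
  fixes Q :: "real^'n^'n"
    and Z :: "(real^'n) set"
    and ix :: "nat \<Rightarrow> 'n"
    and \<psi> :: "nat \<Rightarrow> 's \<Rightarrow> bool \<Rightarrow> 's option"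
    and \<sigma>0 :: 's
    and N :: "('n, 's) dd_node set"
    and A :: "('n, 's) dd_arc set"
    and x z :: "real^'n"
    and x0 :: real
  assumes numbering: "bij_betw ix {1..CARD('n)} UNIV"
    and Q_sym: "transpose Q = Q"
    and Q_pos_def: "pos_def_matrix Q"
    and Z_binary: "Z \<subseteq> binary_cube"
    and encodes: "dp_encodes ix \<psi> \<sigma>0 Z"
    and N_def: "N = dd_nodes ix Q \<psi> \<sigma>0"
    and A_def: "A = dd_arcs ix Q \<psi> \<sigma>0"
  shows "(x, z, x0) \<in> convex hull (X_set Q Z) \<longleftrightarrow>
    (\<exists>r w :: ('n, 's) dd_arc \<Rightarrow> real.
       ereal x0 \<ge> (\<Sum>a\<in>A. ereal ((w a)\<^sup>2) / ereal (r a)) \<and>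
       x = (\<Sum>a\<in>A. w a *\<^sub>R arc_vec ix Q a) \<and>
       z = (\<Sum>a\<in>{a\<in>A. arc_value a}. r a *\<^sub>R axis (ix (arc_layer a)) 1) \<and>
       (\<forall>v\<in>N. 2 \<le> node_layer v \<and> node_layer v \<le> CARD('n) \<longrightarrow>
          (\<Sum>a\<in>{a\<in>A. arc_head ix Q \<psi> a = v}. r a) = (\<Sum>a\<in>{a\<in>A. arc_tail a = v}. r a)) \<and>
       (\<Sum>a\<in>{a\<in>A. arc_layer a = 1}. r a) = 1 \<and>
       (\<Sum>a\<in>{a\<in>A. arc_layer a = CARD('n)}. r a) = 1 \<and>
       (\<forall>a\<in>A. r a \<ge> 0))"
proof -
  interpret compressed_diagram ix Q \<psi> \<sigma>0
    by unfold_locales (fact numbering Q_sym Q_pos_def)+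
  have "dd_feasible x z x0 r w \<longleftrightarrow>
       ereal x0 \<ge> (\<Sum>a\<in>A. ereal ((w a)\<^sup>2) / ereal (r a)) \<and>
       x = (\<Sum>a\<in>A. w a *\<^sub>R arc_vec ix Q a) \<and>
       z = (\<Sum>a\<in>{a\<in>A. arc_value a}. r a *\<^sub>R axis (ix (arc_layer a)) 1) \<and>
       (\<forall>v\<in>N. 2 \<le> node_layer v \<and> node_layer v \<le> CARD('n) \<longrightarrow>
          (\<Sum>a\<in>{a\<in>A. head a = v}. r a) = (\<Sum>a\<in>{a\<in>A. arc_tail a = v}. r a)) \<and>
       (\<Sum>a\<in>{a\<in>A. arc_layer a = 1}. r a) = 1 \<and>
       (\<Sum>a\<in>{a\<in>A. arc_layer a = CARD('n)}. r a) = 1 \<and>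
       (\<forall>a\<in>A. r a \<ge> 0)" for r w
  \<comment> \<open>Nonnegativity of \<open>r\<close> is a conjunct on both sides: without it both
    are false, and with it only the two forms of the cost constraint have to be matched.\<close>
  proof (cases "\<forall>a\<in>A. r a \<ge> 0")
    case True
    have "finite A" unfolding A_def by (rule finite_dd_arcs)
    from ereal_quotient_sum_le_iff[OF this True] show ?thesis
      unfolding dd_feasible_def flow_conservation_def N_def[symmetric] A_def[symmetric]
      by (simp only: conj_assoc)
  next
    case False
    then show ?thesis unfolding dd_feasible_def A_def[symmetric] by (simp only: simp_thms)
  qed
  then show ?thesis by (simp only: hull_X_set_iff_feasible[OF encodes])
qed

end
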